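(* Let $T>0$, $\beta\in(0,1)$, let $X=\{X_t\}_{t\in[0,T]}$ with $X_0=0$ and $a=\{a_t\}_{t\in[0,T]}$ be real-valued stochastic processes on a complete probability space $(\Omega,\mathcal F,\mathbb P)$ (not assumed independent, not assumed continuous) such that the Lebesgue integrals $\int_0^t a_s\,\mathrm ds$ are well defined, and set $y_t=X_t+\int_0^t a_s\,\mathrm ds$ for $t\in[0,T]$. Then for every $\epsilon>0$, $$\mathbb P(\|y\|_\beta\le\epsilon)\le \inf_{p>0}\ \inf_{(N,\delta,I)\in\widetilde{\mathcal A}_p(\epsilon)}\Big\{\mathbb P\big(\big||\mathbf X|_p-I\big|\ge 2^{-2}I\big)+\mathbb P\big(\|a\|_\infty\ge 2^{-2}I N^{-1/p}\delta^{-1}\big)\Big\}.$$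
   Context: $\|f\|_\infty=\sup_{t\in[0,T]}|f_t|$ and $\|f\|_\beta=\sup_{0\le s\ne t\le T}\frac{|f(t)-f(s)|}{|t-s|^\beta}$. For $p>0$, $N\in\mathbb N=\{1,2,\dots\}$ and $\delta>0$ with $N\delta\le T$, put $t_k=k\delta$ for $k=0,\dots,N$ and $$|\mathbf X|_p=\Big[\sum_{k=1}^N|X_{t_k}-X_{t_{k-1}}|^p\Big]^{1/p}$$ (this depends on $N$ and $\delta$). With $\mathbb R_+=(0,\infty)$, $$\widetilde{\mathcal A}_p(\epsilon)=\big\{(N,\delta,I)\in\mathbb N\times\mathbb R_+\times\mathbb R_+ : 2\delta^\beta N^{1/p}\le I\epsilon^{-1},\ N\delta\le T\big\}.$$ It is understood that $\|y\|_\beta$ and $\|a\|_\infty$ are ($[0,\infty]$-valued) random variables. *)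

theory Defs
  imports "HOL-Probability.Probability"
begin

text \<open>The two path functionals take values in the extended half-line, so that unbounded
  or non-Hoelder paths are assigned the value infinity.\<close>

definition sup_norm_on :: "real \<Rightarrow> (real \<Rightarrow> real) \<Rightarrow> ennreal" where
  "sup_norm_on T f = (SUP t\<in>{0..T}. ennreal \<bar>f t\<bar>)"

definition holder_seminorm_on :: "real \<Rightarrow> real \<Rightarrow> (real \<Rightarrow> real) \<Rightarrow> ennreal" where
  "holder_seminorm_on T \<beta> f =
     (SUP (s, t)\<in>{(s, t). s \<in> {0..T} \<and> t \<in> {0..T} \<and> s \<noteq> t}.
        ennreal (\<bar>f t - f s\<bar> / \<bar>t - s\<bar> powr \<beta>))"

definition increment_norm :: "real \<Rightarrow> nat \<Rightarrow> real \<Rightarrow> (real \<Rightarrow> real) \<Rightarrow> real" where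
  "increment_norm p N \<delta> f =
     (\<Sum>k=1..N. \<bar>f (real k * \<delta>) - f (real (k - 1) * \<delta>)\<bar> powr p) powr (1 / p)"

definition admissible :: "real \<Rightarrow> real \<Rightarrow> real \<Rightarrow> real \<Rightarrow> (nat \<times> real \<times> real) set" where
  "admissible T \<beta> p \<epsilon> =
     {(N, \<delta>, I). N \<ge> 1 \<and> \<delta> > 0 \<and> I > 0 \<and>
        2 * \<delta> powr \<beta> * real N powr (1 / p) \<le> I / \<epsilon> \<and> real N * \<delta> \<le> T}"

end

theory Submission
  imports Defs
begin

text \<open>Fix \<open>p\<close> and an admissible \<open>(N, \<delta>, I)\<close>. If the Hoelder seminorm of \<open>y\<close> is at most \<open>\<epsilon>\<close> and
  \<open>\<bar>a\<bar>\<close> stays below \<open>I N\<^sup>-\<^sup>1\<^sup>/\<^sup>p / (4 \<delta>)\<close>, then each increment of \<open>X = y - \<integral>a\<close> over a step of length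
  \<open>\<delta>\<close> is at most \<open>\<epsilon> \<delta>\<^sup>\<beta> + I N\<^sup>-\<^sup>1\<^sup>/\<^sup>p / 4 \<le> (3/4) I N\<^sup>-\<^sup>1\<^sup>/\<^sup>p\<close>. Bounding the increments one by one, which
  needs no triangle inequality and hence allows \<open>p < 1\<close>, keeps the \<open>p\<close>-norm of the increments
  at most \<open>(3/4) I\<close>, that is, at distance at least \<open>I/4\<close> from \<open>I\<close>. So almost surely one of the two
  events on the right occurs.\<close>

lemma abs_diff_le_of_holder_seminorm_on_le:
  assumes "holder_seminorm_on T \<beta> f \<le> ennreal C" "0 \<le> C"
    and "s \<in> {0..T}" "t \<in> {0..T}"
  shows "\<bar>f t - f s\<bar> \<le> C * \<bar>t - s\<bar> powr \<beta>"
proof (cases "s = t")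
  case False
  then have "ennreal (\<bar>f t - f s\<bar> / \<bar>t - s\<bar> powr \<beta>) \<le> holder_seminorm_on T \<beta> f"
    unfolding holder_seminorm_on_def using assms by (intro SUP_upper2[of "(s, t)"]) auto
  then have "\<bar>f t - f s\<bar> / \<bar>t - s\<bar> powr \<beta> \<le> C"
    using assms by (metis ennreal_le_iff order_trans)
  then show ?thesis
    using False by (simp add: divide_le_eq)
qed simp

lemma abs_le_of_sup_norm_on_less:
  assumes "sup_norm_on T f < ennreal C" "t \<in> {0..T}"
  shows "\<bar>f t\<bar> \<le> C"
proof -
  have "ennreal \<bar>f t\<bar> \<le> sup_norm_on T f"
    unfolding sup_norm_on_def using assms(2) by (rule SUP_upper)
  also note assms(1)
  finally have "ennreal \<bar>f t\<bar> < ennreal C" .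
  \<comment> \<open>\<open>ennreal\<close> sends negative reals to 0, so the strict inequality
    forces C > 0 and transfers to the reals.\<close>
  then show ?thesis
    by (simp add: ennreal_less_iff)
qed

lemma abs_set_lebesgue_integral_diff_le:
  fixes f :: "real \<Rightarrow> real"
  assumes int: "set_integrable lebesgue {0..t} f"
    and "0 \<le> s" "s \<le> t" and bound: "\<And>u. u \<in> {0..t} \<Longrightarrow> \<bar>f u\<bar> \<le> C"
  shows "\<bar>(LINT u:{0..t}|lebesgue. f u) - (LINT u:{0..s}|lebesgue. f u)\<bar> \<le> C * (t - s)"
proof -
  have ints: "set_integrable lebesgue {0..s} f" "set_integrable lebesgue {s<..t} f"
    using assms by (auto intro: set_integrable_subset[OF int])
  \<comment> \<open>The left end is open to make the splitting disjoint; the difference of integrals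
    becomes one integral over a set of length t - s.\<close>
  have "{0..t} = {0..s} \<union> {s<..t}" "{0..s} \<inter> {s<..t} = {}"
    using assms by auto
  then have "(LINT u:{0..t}|lebesgue. f u) - (LINT u:{0..s}|lebesgue. f u)
      = (LINT u:{s<..t}|lebesgue. f u)"
    using set_integral_Un[OF _ ints] by simp
  also have "\<bar>\<dots>\<bar> \<le> (LINT u:{s<..t}|lebesgue. \<bar>f u\<bar>)"
    using set_integral_norm_bound[OF ints(2)] by simp
  also have "\<dots> \<le> (LINT u:{s<..t}|lebesgue. C)"
  proof (rule set_integral_mono)
    show "set_integrable lebesgue {s<..t} (\<lambda>u. \<bar>f u\<bar>)"
      using ints(2) by (rule set_integrable_abs)
    show "set_integrable lebesgue {s<..t} (\<lambda>u. C)"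
      using \<open>s \<le> t\<close> by (auto simp: set_integrable_def)
  qed (use assms in auto)
  also have "\<dots> = C * (t - s)"
    using \<open>s \<le> t\<close> by (simp add: set_lebesgue_integral_def)
  finally show ?thesis .
qed

lemma increment_norm_le:
  assumes "p > 0" "C \<ge> 0"
    and "\<And>k. k \<in> {1..N} \<Longrightarrow> \<bar>f (real k * \<delta>) - f (real (k - 1) * \<delta>)\<bar> \<le> C"
  shows "increment_norm p N \<delta> f \<le> C * real N powr (1 / p)"
proof -
  have "(\<Sum>k=1..N. \<bar>f (real k * \<delta>) - f (real (k - 1) * \<delta>)\<bar> powr p) \<le> (\<Sum>k=1..N. C powr p)"
    using assms by (intro sum_mono powr_mono2) auto
  then have "increment_norm p N \<delta> f \<le> (real N * C powr p) powr (1 / p)"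
    unfolding increment_norm_def using assms by (intro powr_mono2) (auto intro: sum_nonneg)
  also have "\<dots> = C * real N powr (1 / p)"
    using assms by (simp add: powr_mult powr_powr)
  finally show ?thesis .
qed

text \<open>Pathwise core: \<open>x\<close>, \<open>b\<close>, \<open>z\<close> are the trajectories
  of X, a, y at one fixed outcome. The constant 3/4 is 1/2 from the Hoelder part plus 1/4 from the
  drift.\<close>

lemma increment_norm_le_of_holder_of_drift:
  fixes x b z :: "real \<Rightarrow> real"
  assumes adm: "(N, \<delta>, I) \<in> admissible T \<beta> p \<epsilon>" and "p > 0" "\<epsilon> > 0"
    and int: "\<And>t. t \<in> {0..T} \<Longrightarrow> set_integrable lebesgue {0..t} b"
    and z: "\<And>t. t \<in> {0..T} \<Longrightarrow> z t = x t + (LINT s:{0..t}|lebesgue. b s)"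
    and holder: "holder_seminorm_on T \<beta> z \<le> ennreal \<epsilon>"
    and sup: "sup_norm_on T b < ennreal (I / 4 * real N powr (- 1 / p) * inverse \<delta>)"
  shows "increment_norm p N \<delta> x \<le> 3 / 4 * I"
proof -
  \<comment> \<open>Chosen so that \<open>c * \<delta> * real N powr (1 / p)\<close> equals
    I/4.\<close>
  define c where "c = I / 4 * real N powr (- 1 / p) * inverse \<delta>"
  have N: "N \<ge> 1" and \<delta>: "\<delta> > 0" and I: "I > 0" and NT: "real N * \<delta> \<le> T"
    and I\<epsilon>: "2 * \<delta> powr \<beta> * real N powr (1 / p) \<le> I / \<epsilon>"
    using adm by (auto simp: admissible_def)
  have inv: "real N powr (- 1 / p) * real N powr (1 / p) = 1"
    using N by (simp flip: powr_add)
  have step: "\<bar>x (real k * \<delta>) - x (real (k - 1) * \<delta>)\<bar> \<le> \<epsilon> * \<delta> powr \<beta> + c * \<delta>"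
    if k: "k \<in> {1..N}" for k
  proof -
    let ?s = "real (k - 1) * \<delta>" and ?t = "real k * \<delta>"
    \<comment> \<open>Since k is at least 1, the truncated subtraction \<open>k - 1\<close> is the
      true one.\<close>
    have ts: "?t - ?s = \<delta>"
      using k by (simp add: of_nat_diff algebra_simps)
    have "?t \<le> real N * \<delta>"
      using k \<delta> by (intro mult_right_mono) auto
    also note NT
    finally have "?t \<le> T" .
    moreover have le: "0 \<le> ?s" "?s \<le> ?t"
      using \<delta> ts by (simp, linarith)
    ultimately have mem: "?s \<in> {0..T}" "?t \<in> {0..T}"
      unfolding atLeastAtMost_iff by linarith+
    have "\<bar>z ?t - z ?s\<bar> \<le> \<epsilon> * \<delta> powr \<beta>"
      using abs_diff_le_of_holder_seminorm_on_le[OF holder _ mem] \<open>\<epsilon> > 0\<close> \<delta> ts by simp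
    moreover have "\<bar>(LINT u:{0..?t}|lebesgue. b u) - (LINT u:{0..?s}|lebesgue. b u)\<bar> \<le> c * (?t - ?s)"
      using sup mem
      by (intro abs_set_lebesgue_integral_diff_le int le abs_le_of_sup_norm_on_less[of T])
        (auto simp: c_def)
    ultimately show ?thesis
      unfolding z[OF mem(1)] z[OF mem(2)] ts by linarith
  qed
  have "increment_norm p N \<delta> x \<le> (\<epsilon> * \<delta> powr \<beta> + c * \<delta>) * real N powr (1 / p)"
    using step \<open>p > 0\<close> \<open>\<epsilon> > 0\<close> \<delta> I by (intro increment_norm_le) (auto simp: c_def)
  also have "\<dots> = \<epsilon> * (\<delta> powr \<beta> * real N powr (1 / p))
      + I / 4 * (real N powr (- 1 / p) * real N powr (1 / p))"
    using \<delta> by (simp add: c_def field_simps)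
  \<comment> \<open>Admissibility, multiplied by \<epsilon>/2, bounds the first term by I/2;
    \<open>inv\<close> cancels the powers of N in the second.\<close>
  also have "\<dots> \<le> I / 2 + I / 4"
    using I\<epsilon> \<open>\<epsilon> > 0\<close> unfolding inv by (simp add: field_simps)
  finally show ?thesis
    by simp
qed

theorem theorem2p3:
  fixes M :: "'w measure"
    and X a y :: "real \<Rightarrow> 'w \<Rightarrow> real"
    and T \<beta> \<epsilon> :: real
  assumes "prob_space M"
    and "complete_measure M"
    and "T > 0" and "0 < \<beta>" and "\<beta> < 1"
    and "\<And>t. t \<in> {0..T} \<Longrightarrow> X t \<in> borel_measurable M"
    and "\<And>t. t \<in> {0..T} \<Longrightarrow> a t \<in> borel_measurable M"
    and "AE \<omega> in M. X 0 \<omega> = 0"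
    and "AE \<omega> in M. \<forall>t\<in>{0..T}. set_integrable lebesgue {0..t} (\<lambda>s. a s \<omega>)"
    and "\<And>t \<omega>. t \<in> {0..T} \<Longrightarrow> \<omega> \<in> space M \<Longrightarrow>
           y t \<omega> = X t \<omega> + (LINT s:{0..t}|lebesgue. a s \<omega>)"
    and "(\<lambda>\<omega>. holder_seminorm_on T \<beta> (\<lambda>t. y t \<omega>)) \<in> borel_measurable M"
    and "(\<lambda>\<omega>. sup_norm_on T (\<lambda>t. a t \<omega>)) \<in> borel_measurable M"
    and "\<epsilon> > 0"
  shows "emeasure M {\<omega>\<in>space M. holder_seminorm_on T \<beta> (\<lambda>t. y t \<omega>) \<le> ennreal \<epsilon>}
    \<le> (INF p\<in>{0<..}. INF (N, \<delta>, I)\<in>admissible T \<beta> p \<epsilon>.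
          emeasure M {\<omega>\<in>space M. \<bar>increment_norm p N \<delta> (\<lambda>t. X t \<omega>) - I\<bar> \<ge> I / 2 ^ 2}
        + emeasure M {\<omega>\<in>space M. sup_norm_on T (\<lambda>t. a t \<omega>)
                        \<ge> ennreal (I / 2 ^ 2 * real N powr (- 1 / p) * inverse \<delta>)})"
proof (intro INF_greatest, clarify)
  fix p :: real and N :: nat and \<delta> I :: real
  assume p: "p > 0" and adm: "(N, \<delta>, I) \<in> admissible T \<beta> p \<epsilon>"
  let ?H = "{\<omega>\<in>space M. holder_seminorm_on T \<beta> (\<lambda>t. y t \<omega>) \<le> ennreal \<epsilon>}"
  let ?A = "{\<omega>\<in>space M. \<bar>increment_norm p N \<delta> (\<lambda>t. X t \<omega>) - I\<bar> \<ge> I / 2 ^ 2}"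
  let ?B = "{\<omega>\<in>space M. sup_norm_on T (\<lambda>t. a t \<omega>)
      \<ge> ennreal (I / 2 ^ 2 * real N powr (- 1 / p) * inverse \<delta>)}"
  have \<delta>: "\<delta> > 0" and NT: "real N * \<delta> \<le> T"
    using adm by (auto simp: admissible_def)
  have X: "X (real k * \<delta>) \<in> borel_measurable M" if "k \<le> N" for k
  proof (rule assms(6))
    have "real k * \<delta> \<le> real N * \<delta>"
      using that \<delta> by (intro mult_right_mono) auto
    also note NT
    finally show "real k * \<delta> \<in> {0..T}"
      using \<delta> by simp
  qed
  \<comment> \<open>Only finitely many grid values of X enter. Measurability of \<open>?A\<close>
    and \<open>?B\<close> matters because \<open>emeasure\<close> is 0 outside
    \<open>sets M\<close>, which could break the upper bound.\<close>
  have "(\<lambda>\<omega>. increment_norm p N \<delta> (\<lambda>t. X t \<omega>)) \<in> borel_measurable M"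
    unfolding increment_norm_def
    by (intro powr_real_measurable borel_measurable_sum borel_measurable_abs
          borel_measurable_diff X borel_measurable_const) auto
  then have A: "?A \<in> sets M"
    by (intro borel_measurable_le borel_measurable_const borel_measurable_abs borel_measurable_diff)
  have B: "?B \<in> sets M"
    by (intro borel_measurable_le borel_measurable_const assms(12))
  \<comment> \<open>The inclusion is claimed almost surely because the drift is integrable only off
    a null set.\<close>
  have "AE \<omega> in M. \<omega> \<in> ?H \<longrightarrow> \<omega> \<in> ?A \<union> ?B"
    using assms(9) AE_space
  proof eventually_elim
    case (elim \<omega>)
    show ?case
    proof (intro impI, rule ccontr)
      assume H: "\<omega> \<in> ?H" and "\<omega> \<notin> ?A \<union> ?B"
      then have near: "\<bar>increment_norm p N \<delta> (\<lambda>t. X t \<omega>) - I\<bar> < I / 4"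
        and small: "sup_norm_on T (\<lambda>t. a t \<omega>)
          < ennreal (I / 4 * real N powr (- 1 / p) * inverse \<delta>)"
        by (simp_all add: not_le)
      have "increment_norm p N \<delta> (\<lambda>t. X t \<omega>) \<le> 3 / 4 * I"
      proof (rule increment_norm_le_of_holder_of_drift[OF adm p \<open>\<epsilon> > 0\<close> _ _ _ small])
        show "holder_seminorm_on T \<beta> (\<lambda>t. y t \<omega>) \<le> ennreal \<epsilon>"
          using H by simp
      qed (use elim assms(10) in blast)+
      \<comment> \<open>\<open>near\<close> puts the norm strictly above I - I/4.\<close>
      with near show False
        by linarith
    qed
  qed
  then have "emeasure M ?H \<le> emeasure M (?A \<union> ?B)"
    using sets.Un[OF A B] by (rule emeasure_mono_AE)
  also have "\<dots> \<le> emeasure M ?A + emeasure M ?B"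
    using A B by (rule emeasure_subadditive)
  finally show "emeasure M ?H \<le> emeasure M ?A + emeasure M ?B" .
qed

end
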